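(* Let $A$ be a bounded pseudo-BCK algebra and let $\mathcal W=\mathcal{SM}(A)\ne\emptyset$ be the set of state-morphisms on $A$. Then $\mathcal F_{\mathcal W}=\mathcal{BS}(A)$, i.e., the de Finetti maps on $A$ with respect to $\mathcal W$ are exactly the Bosbach states on $A$.
   Context: A pseudo-BCK algebra is a structure $(A,\le,\rightarrow,\rightsquigarrow,1)$ with $\le$ a binary relation, $\rightarrow,\rightsquigarrow$ binary operations and $1\in A$, such that for all $x,y,z\in A$: $x\rightarrow y\le (y\rightarrow z)\rightsquigarrow(x\rightarrow z)$ and $x\rightsquigarrow y\le (y\rightsquigarrow z)\rightarrow(x\rightsquigarrow z)$; $x\le (x\rightarrow y)\rightsquigarrow y$ and $x\le (x\rightsquigarrow y)\rightarrow y$; $x\le x$; $x\le 1$; antisymmetry of $\le$; $x\le y$ iff $x\rightarrow y=1$ iff $x\rightsquigarrow y=1$. It is bounded if it has a least element $0$. A Bosbach state is a map $s:A\to[0,1]$ with $s(x)+s(x\rightarrow y)=s(y)+s(y\rightarrow x)$, $s(x)+s(x\rightsquigarrow y)=s(y)+s(y\rightsquigarrow x)$, $s(0)=0$, $s(1)=1$; $\mathcal{BS}(A)$ is the set of Bosbach states. A state-morphism is a map $m:A\to[0,1]$ with $m(0)=0$ and $m(x\rightarrow y)=m(x\rightsquigarrow y)=\min\{1-m(x)+m(y),1\}$. For $\mathcal W\subseteq[0,1]^A$: a map $\beta:A'\to[0,1]$ on a finite subset $A'=\{a_1,\dots,a_n\}\subseteq A$ is coherent over $A'$ if for all $\sigma_1,\dots,\sigma_n\in\mathbb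 R$ there is $V\in\mathcal W$ with $\sum_{i=1}^n\sigma_i(\beta(a_i)-V(a_i))\ge0$; a de Finetti map is a function $\beta:A\to[0,1]$ coherent over every finite subset of $A$; $\mathcal F_{\mathcal W}$ is the set of de Finetti maps. *)

theory Defs
  imports Complex_Main
begin

text \<open>
  The carrier of the algebra is a whole type. The symbols are bold so that they do not
  clash with the function space notation of \<open>HOL-Library.FuncSet\<close>.
\<close>

locale pseudo_BCK =
  fixes le :: "'a \<Rightarrow> 'a \<Rightarrow> bool" (infix "\<^bold>\<le>" 50)
    and imp1 :: "'a \<Rightarrow> 'a \<Rightarrow> 'a" (infixr "\<^bold>\<rightarrow>" 60)
    and imp2 :: "'a \<Rightarrow> 'a \<Rightarrow> 'a" (infixr "\<^bold>\<leadsto>" 60)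
    and one :: 'a ("\<^bold>1")
  assumes imp1_trans: "(x \<^bold>\<rightarrow> y) \<^bold>\<le> ((y \<^bold>\<rightarrow> z) \<^bold>\<leadsto> (x \<^bold>\<rightarrow> z))"
    and imp2_trans: "(x \<^bold>\<leadsto> y) \<^bold>\<le> ((y \<^bold>\<leadsto> z) \<^bold>\<rightarrow> (x \<^bold>\<leadsto> z))"
    and le_imp1_imp2: "x \<^bold>\<le> ((x \<^bold>\<rightarrow> y) \<^bold>\<leadsto> y)"
    and le_imp2_imp1: "x \<^bold>\<le> ((x \<^bold>\<leadsto> y) \<^bold>\<rightarrow> y)"
    and le_refl: "x \<^bold>\<le> x"
    and le_one: "x \<^bold>\<le> \<^bold>1"
    and le_antisym: "x \<^bold>\<le> y \<Longrightarrow> y \<^bold>\<le> x \<Longrightarrow> x = y"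
    and le_iff_imp1: "x \<^bold>\<le> y \<longleftrightarrow> (x \<^bold>\<rightarrow> y) = \<^bold>1"
    and le_iff_imp2: "x \<^bold>\<le> y \<longleftrightarrow> (x \<^bold>\<leadsto> y) = \<^bold>1"

locale bounded_pseudo_BCK = pseudo_BCK le imp1 imp2 one
  for le :: "'a \<Rightarrow> 'a \<Rightarrow> bool" (infix "\<^bold>\<le>" 50)
    and imp1 :: "'a \<Rightarrow> 'a \<Rightarrow> 'a" (infixr "\<^bold>\<rightarrow>" 60)
    and imp2 :: "'a \<Rightarrow> 'a \<Rightarrow> 'a" (infixr "\<^bold>\<leadsto>" 60)
    and one :: 'a ("\<^bold>1") +
  fixes zero :: 'a ("\<^bold>0")
  assumes zero_le: "\<^bold>0 \<^bold>\<le> x"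

definition bosbach_states ::
    "('a \<Rightarrow> 'a \<Rightarrow> 'a) \<Rightarrow> ('a \<Rightarrow> 'a \<Rightarrow> 'a) \<Rightarrow> 'a \<Rightarrow> 'a \<Rightarrow> ('a \<Rightarrow> real) set" where
  "bosbach_states imp1 imp2 one zero =
    {s. (\<forall>x. s x \<in> {0..1}) \<and>
        (\<forall>x y. s x + s (imp1 x y) = s y + s (imp1 y x)) \<and>
        (\<forall>x y. s x + s (imp2 x y) = s y + s (imp2 y x)) \<and>
        s zero = 0 \<and> s one = 1}"

definition state_morphisms ::
    "('a \<Rightarrow> 'a \<Rightarrow> 'a) \<Rightarrow> ('a \<Rightarrow> 'a \<Rightarrow> 'a) \<Rightarrow> 'a \<Rightarrow> ('a \<Rightarrow> real) set" where
  "state_morphisms imp1 imp2 zero =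
    {m. (\<forall>x. m x \<in> {0..1}) \<and>
        m zero = 0 \<and>
        (\<forall>x y. m (imp1 x y) = min (1 - m x + m y) 1) \<and>
        (\<forall>x y. m (imp2 x y) = min (1 - m x + m y) 1)}"

text \<open>
  Only the values of \<open>\<beta>\<close> on \<open>A'\<close> matter. The coefficients are indexed by the elements of
  \<open>A'\<close> instead of by an enumeration of it. The empty subset is not excluded; coherence over
  it only says that \<open>W\<close> is nonempty.
\<close>

definition coherent_over ::
    "('a \<Rightarrow> real) set \<Rightarrow> 'a set \<Rightarrow> ('a \<Rightarrow> real) \<Rightarrow> bool" where
  "coherent_over W A' \<beta> \<longleftrightarrow>
    (\<forall>a\<in>A'. \<beta> a \<in> {0..1}) \<and>
    (\<forall>\<sigma> :: 'a \<Rightarrow> real. \<exists>V\<in>W. (\<Sum>a\<in>A'. \<sigma> a * (\<beta> a - V a)) \<ge> 0)"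

definition de_finetti_maps :: "('a \<Rightarrow> real) set \<Rightarrow> ('a \<Rightarrow> real) set" where
  "de_finetti_maps W =
    {\<beta>. (\<forall>x. \<beta> x \<in> {0..1}) \<and> (\<forall>A'. finite A' \<longrightarrow> coherent_over W A' \<beta>)}"

end

theory Submission
  imports Defs "HOL-Analysis.Analysis"
begin

text \<open>
  Linear equations satisfied by all state-morphisms pass to coherent maps, so de Finetti maps are
  Bosbach states. For the converse it suffices that every linear functional
  \<open>v \<mapsto> \<Sum>a\<in>A'. \<sigma> a * v a\<close> attains its minimum over the Bosbach states at a state-morphism. The Bosbach
  states form a compact convex subset of the product space, so the minimum is attained at an
  extreme point (Krein--Milman), and we show that extreme Bosbach states are state-morphisms.

  Modulo the kernel of a Bosbach state \<open>s\<close> the algebra behaves like an MV-algebra, in which \<open>s\<close>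
  is a valuation. For an element \<open>c\<close> the limit \<open>r x = lim s (c\<^sup>n \<or> x)\<close> along \<open>n = 1, 2, 4, \<dots>\<close> exists,
  and \<open>s = (r - r 0) + (s - r + r 0)\<close> is a decomposition into multiples of Bosbach states.
  If \<open>s\<close> is extreme, then \<open>r - r 0 = (1 - r 0) s\<close>. Take \<open>c = x \<rightarrow> y\<close> and \<open>d = y \<rightarrow> x\<close>. From
  \<open>r c = s c\<close> either \<open>s c = 1\<close> or \<open>r 0 = 0\<close>; in the latter case \<open>s d = r d = 1\<close>, because
  prelinearity gives \<open>s (c\<^sup>n \<or> d) = 1\<close>. Either alternative determines \<open>s (x \<rightarrow> y)\<close>.
\<close>

section \<open>Pseudo-BCK algebras\<close>

context pseudo_BCK
begin

lemma one_le_iff: "\<^bold>1 \<^bold>\<le> x \<longleftrightarrow> x = \<^bold>1"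
  using le_antisym le_one le_refl by blast

text \<open>The axioms are symmetric in the two implications, so every lemma has a mirror image,
  cited with the prefix \<open>mirror\<close>.\<close>

lemma mirror: "pseudo_BCK (\<^bold>\<le>) (\<^bold>\<leadsto>) (\<^bold>\<rightarrow>) \<^bold>1"
  by unfold_locales
    (fact imp2_trans imp1_trans le_imp2_imp1 le_imp1_imp2 le_refl le_one le_iff_imp1 le_iff_imp2
     | erule (1) le_antisym)+

sublocale mirror: pseudo_BCK "(\<^bold>\<le>)" "(\<^bold>\<leadsto>)" "(\<^bold>\<rightarrow>)" "\<^bold>1"
  by (rule mirror)

lemma imp1_antimono: "x \<^bold>\<le> y \<Longrightarrow> (y \<^bold>\<rightarrow> z) \<^bold>\<le> (x \<^bold>\<rightarrow> z)"
  using imp1_trans[of x y z] by (simp add: le_iff_imp1[of x y] one_le_iff flip: le_iff_imp2)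

lemma imp2_antimono: "x \<^bold>\<le> y \<Longrightarrow> (y \<^bold>\<leadsto> z) \<^bold>\<le> (x \<^bold>\<leadsto> z)"
  using imp2_trans[of x y z] by (simp add: le_iff_imp2[of x y] one_le_iff flip: le_iff_imp1)

lemma le_trans: "x \<^bold>\<le> y \<Longrightarrow> y \<^bold>\<le> z \<Longrightarrow> x \<^bold>\<le> z"
  using imp1_antimono[of x y z] by (metis le_iff_imp1 one_le_iff)

text \<open>Replaces the missing product: both sides would say that the product of \<open>x\<close>
  and \<open>y\<close> lies below \<open>z\<close>.\<close>

lemma residuation: "x \<^bold>\<le> (y \<^bold>\<rightarrow> z) \<longleftrightarrow> y \<^bold>\<le> (x \<^bold>\<leadsto> z)"
  using le_trans imp1_antimono imp2_antimono le_imp1_imp2 le_imp2_imp1 by meson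

lemma imp1_comp: "(y \<^bold>\<rightarrow> z) \<^bold>\<le> ((x \<^bold>\<rightarrow> y) \<^bold>\<rightarrow> (x \<^bold>\<rightarrow> z))"
  using imp1_trans residuation by blast

lemma imp1_mono: "y \<^bold>\<le> z \<Longrightarrow> (x \<^bold>\<rightarrow> y) \<^bold>\<le> (x \<^bold>\<rightarrow> z)"
  using imp1_comp[of y z x] by (metis le_iff_imp1 one_le_iff)

lemma imp_exchange_le: "(y \<^bold>\<leadsto> (x \<^bold>\<rightarrow> z)) \<^bold>\<le> (x \<^bold>\<rightarrow> (y \<^bold>\<leadsto> z))"
  using imp2_trans imp1_antimono[OF le_imp1_imp2] le_trans by meson

lemma le_imp1: "y \<^bold>\<le> (x \<^bold>\<rightarrow> y)"
  using residuation le_refl le_iff_imp2 le_one by metis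

text \<open>The triple identity of the Galois connection given by \<open>residuation\<close> for
  fixed \<open>y\<close>.\<close>

lemma join_imp1: "(((x \<^bold>\<rightarrow> y) \<^bold>\<leadsto> y) \<^bold>\<rightarrow> y) = (x \<^bold>\<rightarrow> y)"
  by (intro le_antisym imp1_antimono le_imp1_imp2 le_imp2_imp1)

end

text \<open>Reopening a context makes the mirror images of the preceding lemmas available.\<close>

context pseudo_BCK
begin

lemma imp_exchange: "(x \<^bold>\<rightarrow> (y \<^bold>\<leadsto> z)) = (y \<^bold>\<leadsto> (x \<^bold>\<rightarrow> z))"
  by (intro le_antisym imp_exchange_le mirror.imp_exchange_le)

lemma join_mono: "x \<^bold>\<le> y \<Longrightarrow> ((x \<^bold>\<rightarrow> z) \<^bold>\<leadsto> z) \<^bold>\<le> ((y \<^bold>\<rightarrow> z) \<^bold>\<leadsto> z)"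
  by (intro imp1_antimono imp2_antimono)

end

section \<open>The preorder and the lattice structure induced by a Bosbach state\<close>

locale bosbach_state = bounded_pseudo_BCK le imp1 imp2 one zero
  for le :: "'a \<Rightarrow> 'a \<Rightarrow> bool" (infix "\<^bold>\<le>" 50)
    and imp1 :: "'a \<Rightarrow> 'a \<Rightarrow> 'a" (infixr "\<^bold>\<rightarrow>" 60)
    and imp2 :: "'a \<Rightarrow> 'a \<Rightarrow> 'a" (infixr "\<^bold>\<leadsto>" 60)
    and one :: 'a ("\<^bold>1")
    and zero :: 'a ("\<^bold>0") +
  fixes s :: "'a \<Rightarrow> real"
  assumes bosbach: "s \<in> bosbach_states (\<^bold>\<rightarrow>) (\<^bold>\<leadsto>) \<^bold>1 \<^bold>0"
begin

lemma mirror_state: "bosbach_state (\<^bold>\<le>) (\<^bold>\<leadsto>) (\<^bold>\<rightarrow>) \<^bold>1 \<^bold>0 s"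
proof (intro bosbach_state.intro bounded_pseudo_BCK.intro mirror)
  show "bounded_pseudo_BCK_axioms (\<^bold>\<le>) \<^bold>0" by unfold_locales (rule zero_le)
  show "bosbach_state_axioms (\<^bold>\<leadsto>) (\<^bold>\<rightarrow>) \<^bold>1 \<^bold>0 s"
    using bosbach by unfold_locales (auto simp: bosbach_states_def)
qed

sublocale mirror: bosbach_state "(\<^bold>\<le>)" "(\<^bold>\<leadsto>)" "(\<^bold>\<rightarrow>)" "\<^bold>1" "\<^bold>0" s
  by (rule mirror_state)

lemma s_bounds: "0 \<le> s x" "s x \<le> 1"
  using bosbach by (auto simp: bosbach_states_def)

lemma s_zero: "s \<^bold>0 = 0" and s_one: "s \<^bold>1 = 1"
  using bosbach by (auto simp: bosbach_states_def)

lemma s_imp1_comm: "s x + s (x \<^bold>\<rightarrow> y) = s y + s (y \<^bold>\<rightarrow> x)"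
  using bosbach by (auto simp: bosbach_states_def)

lemma s_imp1_of_le:
  assumes "y \<^bold>\<le> x"
  shows "s (x \<^bold>\<rightarrow> y) = 1 - s x + s y"
  using s_imp1_comm[of x y] assms by (simp add: le_iff_imp1 s_one)

lemma s_mono: "x \<^bold>\<le> y \<Longrightarrow> s x \<le> s y"
  using s_imp1_of_le s_bounds(2)[of "y \<^bold>\<rightarrow> x"] by fastforce

text \<open>
  \<open>sjoin x y\<close> is the least value of \<open>s\<close> on common upper bounds of \<open>x\<close> and \<open>y\<close>; this makes it
  symmetric and independent of which of the two implications is used.
\<close>

definition sjoin :: "'a \<Rightarrow> 'a \<Rightarrow> real" where
  "sjoin x y = s ((x \<^bold>\<rightarrow> y) \<^bold>\<leadsto> y)"

text \<open>The term in \<open>sjoin\<close> lies above \<open>y\<close>, and by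
  \<open>join_imp1\<close> its implication to \<open>y\<close> is again
  \<open>x \<rightarrow> y\<close>. So the formula for comparable elements applies.\<close>

lemma s_imp1: "s (x \<^bold>\<rightarrow> y) = 1 + s y - sjoin x y"
  using s_imp1_of_le[OF mirror.le_imp1[of y "x \<^bold>\<rightarrow> y"]] by (simp add: sjoin_def join_imp1)

lemma sjoin_comm: "sjoin x y = sjoin y x"
  using s_imp1[of x y] s_imp1[of y x] s_imp1_comm[of x y] by simp

lemma sjoin_of_le: "x \<^bold>\<le> y \<Longrightarrow> sjoin x y = s y"
  using s_imp1[of x y] by (simp add: le_iff_imp1 s_one)

text \<open>The term in \<open>sjoin x y\<close> need not lie below \<open>z\<close>; only its value
  is bounded. Replacing \<open>x\<close> by \<open>z\<close> increases it, and symmetry evaluates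
  the result.\<close>

lemma sjoin_le_of_le:
  assumes "x \<^bold>\<le> z" "y \<^bold>\<le> z"
  shows "sjoin x y \<le> s z"
proof -
  have "sjoin x y \<le> sjoin z y"
    unfolding sjoin_def by (intro s_mono join_mono assms)
  then show ?thesis using sjoin_of_le[OF assms(2)] by (simp add: sjoin_comm)
qed

end

context bosbach_state
begin

lemma mirror_sjoin: "mirror.sjoin x y = sjoin x y"
proof (rule antisym)
  show "mirror.sjoin x y \<le> sjoin x y"
    unfolding sjoin_def by (rule mirror.sjoin_le_of_le[OF le_imp1_imp2 mirror.le_imp1])
  show "sjoin x y \<le> mirror.sjoin x y"
    unfolding mirror.sjoin_def by (rule sjoin_le_of_le[OF le_imp2_imp1 le_imp1])
qed

lemma s_imp2: "s (x \<^bold>\<leadsto> y) = s (x \<^bold>\<rightarrow> y)"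
  using s_imp1 mirror.s_imp1 mirror_sjoin by simp

text \<open>The order modulo the kernel of \<open>s\<close>, kept as a preorder so that no quotient
  has to be formed.\<close>

definition sle :: "'a \<Rightarrow> 'a \<Rightarrow> bool" where
  "sle x y \<longleftrightarrow> s (x \<^bold>\<rightarrow> y) = 1"

lemma sle_imp2: "sle x y \<longleftrightarrow> s (x \<^bold>\<leadsto> y) = 1"
  by (simp add: sle_def s_imp2)

lemma sle_iff_sjoin: "sle x y \<longleftrightarrow> sjoin x y = s y"
  using s_imp1 by (auto simp: sle_def)

lemma sle_of_le: "x \<^bold>\<le> y \<Longrightarrow> sle x y"
  by (simp add: sle_def le_iff_imp1 s_one)

lemma sle_s_mono: "sle x y \<Longrightarrow> s x \<le> s y"
  using s_mono[OF le_imp1_imp2, of x y] unfolding sle_iff_sjoin sjoin_def by simp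

lemma sle_of_ge: "x \<^bold>\<le> y \<Longrightarrow> s y \<le> s x \<Longrightarrow> sle y x"
  using s_imp1_of_le s_bounds(2)[of "y \<^bold>\<rightarrow> x"] unfolding sle_def by fastforce

lemma s_eq_one_of_le: "x \<^bold>\<le> y \<Longrightarrow> s x = 1 \<Longrightarrow> s y = 1"
  using s_mono s_bounds(2)[of y] by fastforce

lemma sle_trans:
  assumes "sle x y" "sle y z"
  shows "sle x z"
proof -
  have "sle (x \<^bold>\<rightarrow> y) (x \<^bold>\<rightarrow> z)"
    using s_eq_one_of_le[OF imp1_comp] assms(2) unfolding sle_def by blast
  then show ?thesis
    using sle_s_mono s_bounds(2)[of "x \<^bold>\<rightarrow> z"] assms(1) unfolding sle_def by fastforce
qed

text \<open>Without changing its value, \<open>z\<close> is enlarged to \<open>w\<close> above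
  \<open>x\<close>, to \<open>v\<close> above \<open>y\<close>, and to \<open>u\<close>, a join of
  \<open>v\<close> with \<open>y\<close>. Now \<open>join_mono\<close> gives a genuine inequality,
  and \<open>u\<close> is equivalent to \<open>z\<close> because they are comparable with equal
  values.\<close>

lemma join_sle:
  assumes "sle x z" "sle y z"
  shows "sle ((x \<^bold>\<rightarrow> y) \<^bold>\<leadsto> y) z"
proof -
  define w where "w = ((x \<^bold>\<rightarrow> z) \<^bold>\<leadsto> z)"
  define v where "v = ((y \<^bold>\<rightarrow> w) \<^bold>\<leadsto> w)"
  define u where "u = ((v \<^bold>\<rightarrow> y) \<^bold>\<leadsto> y)"
  have zw: "z \<^bold>\<le> w" and xw: "x \<^bold>\<le> w" and wv: "w \<^bold>\<le> v" and yv: "y \<^bold>\<le> v" and vu: "v \<^bold>\<le> u"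
    unfolding w_def v_def u_def by (rule le_imp1_imp2 mirror.le_imp1)+
  have sw: "s w = s z"
    using assms(1) by (simp add: sle_iff_sjoin sjoin_def w_def)
  have "sle y w" using assms(2) sle_of_le[OF zw] sle_trans by blast
  then have sv: "s v = s w" by (simp add: sle_iff_sjoin sjoin_def v_def)
  have "s u = s v"
    using sjoin_of_le[OF yv] by (simp add: u_def sjoin_comm flip: sjoin_def)
  with sw sv have "sle u z"
    using sle_of_ge[of z u] le_trans zw wv vu by auto
  moreover have "((x \<^bold>\<rightarrow> y) \<^bold>\<leadsto> y) \<^bold>\<le> u"
    unfolding u_def by (intro join_mono le_trans[OF xw wv])
  ultimately show ?thesis using sle_of_le sle_trans by blast
qed

lemma sjoin_least: "sle x z \<Longrightarrow> sle y z \<Longrightarrow> sjoin x y \<le> s z"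
  unfolding sjoin_def by (intro sle_s_mono join_sle)

lemma sjoin_mono:
  assumes "sle x x'" "sle y y'"
  shows "sjoin x y \<le> sjoin x' y'"
  unfolding sjoin_def[of x']
  by (rule sjoin_least; rule sle_trans[OF _ sle_of_le]; fact assms le_imp1_imp2 mirror.le_imp1)

lemma sjoin_upper: "s x \<le> sjoin x y" "s y \<le> sjoin x y"
  unfolding sjoin_def by (rule s_mono, rule le_imp1_imp2 mirror.le_imp1)+

lemma sjoin_le_one: "sjoin x y \<le> 1"
  unfolding sjoin_def by (rule s_bounds)

lemma sjoin_le_add: "sjoin x y \<le> s x + s y"
  using s_imp1[of x y] s_mono[OF imp1_mono[OF zero_le], of x y] s_imp1_of_le[OF zero_le, of x]
  by (simp add: s_zero)

lemma s_imp1_of_sle: "sle y x \<Longrightarrow> s (x \<^bold>\<rightarrow> y) = 1 - s x + s y"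
  using s_imp1[of x y] by (simp add: sle_iff_sjoin sjoin_comm)

lemma s_neg1: "s (x \<^bold>\<rightarrow> \<^bold>0) = 1 - s x" and s_neg2: "s (x \<^bold>\<leadsto> \<^bold>0) = 1 - s x"
  using s_imp1_of_le[OF zero_le, of x] by (simp_all add: s_zero s_imp2)

lemma neg_neg_sle: "sle ((x \<^bold>\<rightarrow> \<^bold>0) \<^bold>\<leadsto> \<^bold>0) x"
  by (rule sle_of_ge[OF le_imp1_imp2]) (simp add: s_neg1 s_neg2)

end

section \<open>Joins with a fixed element and their additivity\<close>

context bosbach_state
begin

lemma mirror_sle: "mirror.sle x y = sle x y"
  by (simp add: sle_def mirror.sle_def s_imp2)

text \<open>Residuation survives modulo the kernel because \<open>imp_exchange\<close> is an
  equation.\<close>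

lemma sle_exchange: "sle x (y \<^bold>\<rightarrow> z) \<longleftrightarrow> sle y (x \<^bold>\<leadsto> z)"
  unfolding sle_def[of y] sle_imp2[of x] by (simp add: imp_exchange)

text \<open>\<open>X\<close> and \<open>Y\<close> are the joins of \<open>e\<close> with
  \<open>x\<close> and \<open>y\<close>. Modulo the kernel, \<open>X \<rightarrow> Y\<close> is an
  upper bound of \<open>e\<close> and \<open>x \<rightarrow> y\<close>, and its value is
  known.\<close>

lemma sjoin_superadditive1:
  assumes "y \<^bold>\<le> x"
  shows "sjoin e x + sjoin e (x \<^bold>\<rightarrow> y) \<le> 1 + sjoin e y"
proof -
  define X where "X = ((e \<^bold>\<rightarrow> x) \<^bold>\<leadsto> x)"
  define Y where "Y = ((e \<^bold>\<rightarrow> y) \<^bold>\<leadsto> y)"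
  have X: "e \<^bold>\<le> X" "x \<^bold>\<le> X" and Y: "e \<^bold>\<le> Y" "y \<^bold>\<le> Y"
    unfolding X_def Y_def by (rule le_imp1_imp2 mirror.le_imp1)+
  have "sle Y X"
    unfolding Y_def by (intro join_sle sle_of_le X le_trans[OF assms])
  then have "s (X \<^bold>\<rightarrow> Y) = 1 - sjoin e x + sjoin e y"
    unfolding s_imp1_of_sle[OF \<open>sle Y X\<close>] by (simp add: X_def Y_def sjoin_def)
  moreover have "x \<^bold>\<le> ((x \<^bold>\<rightarrow> y) \<^bold>\<leadsto> Y)"
    using le_trans[OF le_imp1_imp2 mirror.imp1_mono[OF Y(2)]] .
  then have "sle X ((x \<^bold>\<rightarrow> y) \<^bold>\<leadsto> Y)"
    unfolding X_def by (intro join_sle sle_of_le le_trans[OF Y(1)] mirror.le_imp1)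
  then have "sle (x \<^bold>\<rightarrow> y) (X \<^bold>\<rightarrow> Y)"
    by (simp add: sle_exchange)
  then have "sjoin e (x \<^bold>\<rightarrow> y) \<le> s (X \<^bold>\<rightarrow> Y)"
    by (intro sjoin_least sle_of_le[OF le_trans[OF Y(1) le_imp1]])
  ultimately show ?thesis by simp
qed

text \<open>
  Stands for the product of \<open>e\<close> with itself, which need not exist in the algebra.
\<close>

definition square :: "'a \<Rightarrow> 'a" where
  "square e = ((e \<^bold>\<rightarrow> (e \<^bold>\<rightarrow> \<^bold>0)) \<^bold>\<leadsto> \<^bold>0)"

lemma le_imp1_square: "e \<^bold>\<le> (e \<^bold>\<rightarrow> square e)"
  unfolding square_def imp_exchange by (rule le_imp1_imp2)

lemma square_sle: "sle (square e) e"
  unfolding square_def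
  by (rule sle_trans[OF sle_of_le neg_neg_sle]) (intro imp2_antimono le_imp1)

text \<open>If \<open>G\<close> bounds \<open>square e\<close> and \<open>d\<close>, then
  \<open>e \<rightarrow> G\<close> bounds \<open>e\<close> and \<open>d\<close>, so its value is 1.
  Hence \<open>G\<close> bounds \<open>e\<close> modulo the kernel and has value 1 as well.\<close>

lemma sjoin_square_eq_one:
  assumes "sjoin e d = 1"
  shows "sjoin (square e) d = 1"
proof -
  define G where "G = ((square e \<^bold>\<rightarrow> d) \<^bold>\<leadsto> d)"
  have G: "square e \<^bold>\<le> G" "d \<^bold>\<le> G"
    unfolding G_def by (rule le_imp1_imp2 mirror.le_imp1)+
  have "e \<^bold>\<le> (e \<^bold>\<rightarrow> G)" "d \<^bold>\<le> (e \<^bold>\<rightarrow> G)"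
    using le_trans[OF le_imp1_square imp1_mono[OF G(1)]] le_trans[OF G(2) le_imp1] .
  then have "sjoin e d \<le> s (e \<^bold>\<rightarrow> G)"
    by (intro sjoin_least sle_of_le)
  then have "sle e G" using assms s_bounds(2)[of "e \<^bold>\<rightarrow> G"] by (simp add: sle_def)
  then have "sjoin e d \<le> s G" by (intro sjoin_least sle_of_le[OF G(2)])
  then show ?thesis
    using assms s_bounds(2)[of G] by (simp add: sjoin_def G_def)
qed

text \<open>
  Here \<open>N\<close> plays the role of the negated product of \<open>e \<or> x\<close> and \<open>e \<or> d\<close>, so that its negation
  bounds both \<open>square e\<close> and \<open>y\<close>.
\<close>

lemma sjoin_square_le:
  assumes "N \<^bold>\<le> (e \<^bold>\<rightarrow> (e \<^bold>\<rightarrow> \<^bold>0))" "sle N (y \<^bold>\<rightarrow> \<^bold>0)"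
  shows "sjoin (square e) y \<le> 1 - s N"
proof -
  have "sle (square e) (N \<^bold>\<leadsto> \<^bold>0)"
    unfolding square_def by (intro sle_of_le imp2_antimono assms)
  moreover have "sle y (N \<^bold>\<leadsto> \<^bold>0)"
    using assms(2) by (simp add: sle_exchange)
  ultimately show ?thesis using sjoin_least by (simp flip: s_neg2)
qed

lemma sjoin_subadditive1:
  assumes "y \<^bold>\<le> x"
  shows "1 + sjoin (square e) y \<le> sjoin e x + sjoin e (x \<^bold>\<rightarrow> y)"
proof -
  define d where "d = (x \<^bold>\<rightarrow> y)"
  define X where "X = ((e \<^bold>\<rightarrow> x) \<^bold>\<leadsto> x)"
  define D where "D = ((e \<^bold>\<rightarrow> d) \<^bold>\<leadsto> d)"
  define N where "N = (D \<^bold>\<rightarrow> (X \<^bold>\<rightarrow> \<^bold>0))"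
  have X: "e \<^bold>\<le> X" "x \<^bold>\<le> X" and D: "e \<^bold>\<le> D" "d \<^bold>\<le> D"
    unfolding X_def D_def by (rule le_imp1_imp2 mirror.le_imp1)+
  have xd: "(x \<^bold>\<rightarrow> \<^bold>0) \<^bold>\<le> d" unfolding d_def by (intro imp1_mono zero_le)
  \<comment> \<open>Guarantees that the value of \<open>N\<close> is not truncated.\<close>
  have "(X \<^bold>\<rightarrow> \<^bold>0) \<^bold>\<le> D" using imp1_antimono[OF X(2)] xd D(2) le_trans by blast
  then have sN: "s N = 2 - s D - s X"
    unfolding N_def by (simp add: s_imp1_of_le s_neg1)
  have "s (d \<^bold>\<rightarrow> (x \<^bold>\<rightarrow> \<^bold>0)) = s (y \<^bold>\<rightarrow> \<^bold>0)"
    using s_imp1_of_le[OF xd] s_imp1_of_le[OF assms] by (simp add: s_neg1 d_def)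
  then have "sle (d \<^bold>\<rightarrow> (x \<^bold>\<rightarrow> \<^bold>0)) (y \<^bold>\<rightarrow> \<^bold>0)"
    by (intro sle_of_ge) (simp_all add: d_def imp1_comp)
  moreover have "N \<^bold>\<le> (d \<^bold>\<rightarrow> (x \<^bold>\<rightarrow> \<^bold>0))" "N \<^bold>\<le> (e \<^bold>\<rightarrow> (e \<^bold>\<rightarrow> \<^bold>0))"
    unfolding N_def using X D le_trans imp1_antimono imp1_mono by meson+
  ultimately have "sjoin (square e) y \<le> 1 - s N"
    using sjoin_square_le sle_trans sle_of_le by blast
  then show ?thesis
    unfolding sN by (simp add: sjoin_def X_def D_def d_def)
qed

text \<open>Not a mirror image of \<open>sjoin_subadditive1\<close>, since the same
  \<open>square\<close> is kept. Instead the factors in \<open>N\<close> change places, and the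
  negation of \<open>D\<close> lies below \<open>X\<close> only modulo the kernel.\<close>

lemma sjoin_subadditive2:
  assumes "y \<^bold>\<le> x"
  shows "1 + sjoin (square e) y \<le> sjoin e x + sjoin e (x \<^bold>\<leadsto> y)"
proof -
  define d where "d = (x \<^bold>\<leadsto> y)"
  define X where "X = ((e \<^bold>\<rightarrow> x) \<^bold>\<leadsto> x)"
  define D where "D = ((e \<^bold>\<rightarrow> d) \<^bold>\<leadsto> d)"
  define N where "N = (X \<^bold>\<rightarrow> (D \<^bold>\<rightarrow> \<^bold>0))"
  have X: "e \<^bold>\<le> X" "x \<^bold>\<le> X" and D: "e \<^bold>\<le> D" "d \<^bold>\<le> D"
    unfolding X_def D_def by (rule le_imp1_imp2 mirror.le_imp1)+
  have "(x \<^bold>\<leadsto> \<^bold>0) \<^bold>\<le> d" unfolding d_def by (intro mirror.imp1_mono zero_le)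
  then have "sle (d \<^bold>\<rightarrow> \<^bold>0) x"
    using sle_trans[OF sle_of_le[OF imp1_antimono] mirror.neg_neg_sle[unfolded mirror_sle]]
    by blast
  then have dx: "sle (d \<^bold>\<rightarrow> \<^bold>0) x" "sle (D \<^bold>\<rightarrow> \<^bold>0) X"
    using sle_trans sle_of_le imp1_antimono X(2) D(2) by blast+
  have sN: "s N = 2 - s D - s X"
    unfolding N_def using s_imp1_of_sle[OF dx(2)] by (simp add: s_neg1)
  have "s (x \<^bold>\<rightarrow> (d \<^bold>\<rightarrow> \<^bold>0)) = s (y \<^bold>\<rightarrow> \<^bold>0)"
    using s_imp1_of_sle[OF dx(1)] s_imp1_of_le[OF assms] by (simp add: s_neg1 d_def s_imp2)
  moreover have "(y \<^bold>\<rightarrow> \<^bold>0) \<^bold>\<le> (x \<^bold>\<rightarrow> (d \<^bold>\<rightarrow> \<^bold>0))"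
    using le_trans[OF imp1_comp imp1_antimono[OF le_imp2_imp1]] unfolding d_def .
  ultimately have "sle (x \<^bold>\<rightarrow> (d \<^bold>\<rightarrow> \<^bold>0)) (y \<^bold>\<rightarrow> \<^bold>0)"
    by (intro sle_of_ge) simp_all
  moreover have "N \<^bold>\<le> (x \<^bold>\<rightarrow> (d \<^bold>\<rightarrow> \<^bold>0))" "N \<^bold>\<le> (e \<^bold>\<rightarrow> (e \<^bold>\<rightarrow> \<^bold>0))"
    unfolding N_def using X D le_trans imp1_antimono imp1_mono by meson+
  ultimately have "sjoin (square e) y \<le> 1 - s N"
    using sjoin_square_le sle_trans sle_of_le by blast
  then show ?thesis
    unfolding sN by (simp add: sjoin_def X_def D_def d_def)
qed

end

section \<open>Meets and prelinearity\<close>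

context bosbach_state
begin

lemma sle_imp1_mono: "sle y z \<Longrightarrow> sle (x \<^bold>\<rightarrow> y) (x \<^bold>\<rightarrow> z)"
  using s_eq_one_of_le[OF imp1_comp] unfolding sle_def by blast

lemma s_contrapos: "s ((y \<^bold>\<rightarrow> \<^bold>0) \<^bold>\<leadsto> (x \<^bold>\<rightarrow> \<^bold>0)) = s (x \<^bold>\<rightarrow> y)"
proof (rule antisym)
  show "s ((y \<^bold>\<rightarrow> \<^bold>0) \<^bold>\<leadsto> (x \<^bold>\<rightarrow> \<^bold>0)) \<le> s (x \<^bold>\<rightarrow> y)"
    unfolding imp_exchange[symmetric] by (intro sle_s_mono sle_imp1_mono neg_neg_sle)
  show "s (x \<^bold>\<rightarrow> y) \<le> s ((y \<^bold>\<rightarrow> \<^bold>0) \<^bold>\<leadsto> (x \<^bold>\<rightarrow> \<^bold>0))"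
    by (rule s_mono[OF imp1_trans])
qed

text \<open>The join of the negations, negated; a meet only with respect to \<open>sle\<close>.\<close>

definition meet :: "'a \<Rightarrow> 'a \<Rightarrow> 'a" where
  "meet x y = ((((y \<^bold>\<rightarrow> \<^bold>0) \<^bold>\<leadsto> (x \<^bold>\<rightarrow> \<^bold>0)) \<^bold>\<rightarrow> (x \<^bold>\<rightarrow> \<^bold>0)) \<^bold>\<leadsto> \<^bold>0)"

text \<open>The valuation identity: \<open>s_contrapos\<close> expresses the value of the join of
  the negations through \<open>s (x \<rightarrow> y)\<close>.\<close>

lemma s_meet: "s (meet x y) = s x + s y - sjoin x y"
  using mirror.s_imp1[of "y \<^bold>\<rightarrow> \<^bold>0" "x \<^bold>\<rightarrow> \<^bold>0"] s_imp1[of x y]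
  by (simp add: meet_def s_neg1 s_neg2 s_contrapos mirror.sjoin_def)

lemma meet_sle: "sle (meet x y) x" "sle (meet x y) y"
  unfolding meet_def
  by (rule sle_trans[OF sle_of_le neg_neg_sle], intro imp2_antimono, rule le_imp1 le_imp2_imp1)+

lemma sle_meet:
  assumes "sle z x" "sle z y"
  shows "sle z (meet x y)"
  unfolding meet_def sle_exchange[symmetric]
  by (intro mirror.join_sle[unfolded mirror_sle])
    (simp_all add: sle_exchange sle_trans[OF _ sle_of_le[OF le_imp1_imp2]] assms)

text \<open>After an exchange, \<open>mirror.join_imp1\<close> collapses the right-hand side to the
  contrapositive of \<open>x \<rightarrow> y\<close>.\<close>

lemma imp1_sle_imp1_meet: "sle (x \<^bold>\<rightarrow> y) (x \<^bold>\<rightarrow> meet x y)"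
  unfolding meet_def imp_exchange mirror.join_imp1
  by (rule sle_of_le[OF imp1_trans])

text \<open>The meet \<open>z\<close> of the two implications carries \<open>x\<close> and
  \<open>y\<close> into their meet \<open>m\<close>, hence also their join \<open>u\<close>. So
  \<open>s z \<le> 1 - s u + s m\<close>, which the valuation identities turn into the
  claim.\<close>

lemma prelinear: "sjoin (x \<^bold>\<rightarrow> y) (y \<^bold>\<rightarrow> x) = 1"
proof -
  define z where "z = meet (x \<^bold>\<rightarrow> y) (y \<^bold>\<rightarrow> x)"
  define m where "m = meet x y"
  define u where "u = ((x \<^bold>\<rightarrow> y) \<^bold>\<leadsto> y)"
  have "sle z (x \<^bold>\<rightarrow> m)"
    using sle_trans[OF meet_sle(1) imp1_sle_imp1_meet] by (simp add: z_def m_def)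
  moreover have "sle (meet y x) m"
    unfolding m_def by (intro sle_meet meet_sle)
  then have "sle z (y \<^bold>\<rightarrow> m)"
    using sle_trans[OF meet_sle(2) sle_trans[OF imp1_sle_imp1_meet sle_imp1_mono]]
    by (simp add: z_def)
  ultimately have "sle u (z \<^bold>\<leadsto> m)"
    unfolding u_def by (intro join_sle) (simp_all add: sle_exchange)
  then have "sle z (u \<^bold>\<rightarrow> m)" by (simp add: sle_exchange)
  moreover have "sle m u"
    using sle_trans[OF meet_sle(1) sle_of_le[OF le_imp1_imp2]] by (simp add: m_def u_def)
  ultimately have "s z \<le> 1 - s u + s m"
    using sle_s_mono s_imp1_of_sle by metis
  then show ?thesis
    using s_meet[of x y] s_meet[of "x \<^bold>\<rightarrow> y" "y \<^bold>\<rightarrow> x"] s_imp1[of x y] s_imp1[of y x]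
      sjoin_comm[of x y] sjoin_le_one[of "x \<^bold>\<rightarrow> y" "y \<^bold>\<rightarrow> x"]
    by (simp add: z_def m_def u_def flip: sjoin_def)
qed

section \<open>The limit of the values on the joins with powers\<close>

text \<open>The exponents are powers of two: \<open>power c n\<close> stands for \<open>c\<close> to the \<open>2 ^ n\<close>.\<close>

definition power :: "'a \<Rightarrow> nat \<Rightarrow> 'a" where
  "power c n = (square ^^ n) c"

lemma power_0: "power c 0 = c" and power_Suc: "power c (Suc n) = square (power c n)"
  by (simp_all add: power_def)

lemma power_sle: "sle (power c n) c"
  by (induction n) (auto simp: power_0 power_Suc sle_of_le le_refl intro: sle_trans[OF square_sle])

lemma sjoin_power_eq_one: "sjoin c d = 1 \<Longrightarrow> sjoin (power c n) d = 1"
  by (induction n) (simp_all add: power_0 power_Suc sjoin_square_eq_one)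

definition plim :: "'a \<Rightarrow> 'a \<Rightarrow> real" where
  "plim c x = lim (\<lambda>n. sjoin (power c n) x)"

lemma plim: "(\<lambda>n. sjoin (power c n) x) \<longlonglongrightarrow> plim c x"
proof -
  have "decseq (\<lambda>n. sjoin (power c n) x)"
    by (intro decseq_SucI) (simp add: power_Suc sjoin_mono square_sle sle_of_le le_refl)
  moreover have "0 \<le> sjoin (power c n) x" for n
    by (simp add: sjoin_def s_bounds)
  ultimately have "convergent (\<lambda>n. sjoin (power c n) x)"
    using decseq_convergent convergentI by metis
  then show ?thesis by (simp add: plim_def convergent_LIMSEQ_iff)
qed

lemma plim_mono: "sle x y \<Longrightarrow> plim c x \<le> plim c y"
  by (rule LIMSEQ_le[OF plim plim]) (simp add: sjoin_mono sle_of_le le_refl)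

lemma s_le_plim: "s x \<le> plim c x"
  by (rule LIMSEQ_le_const[OF plim]) (simp add: sjoin_upper)

lemma plim_le_one: "plim c x \<le> 1"
  by (rule LIMSEQ_le_const2[OF plim]) (simp add: sjoin_le_one)

lemma plim_le_add: "plim c x \<le> plim c \<^bold>0 + s x"
proof (rule LIMSEQ_le[OF plim tendsto_add[OF plim tendsto_const]])
  have "sjoin e x \<le> sjoin e \<^bold>0 + s x" for e
    using sjoin_le_add[of e x] sjoin_upper(1)[of e "\<^bold>0"] by simp
  then show "\<exists>N. \<forall>n\<ge>N. sjoin (power c n) x \<le> sjoin (power c n) \<^bold>0 + s x" by blast
qed

lemma plim_self: "plim c c = s c"
proof (rule LIMSEQ_unique[OF plim])
  have "sjoin (power c n) c = s c" for n
    using power_sle sle_iff_sjoin by blast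
  then show "(\<lambda>n. sjoin (power c n) c) \<longlonglongrightarrow> s c" by simp
qed

lemma plim_eq_one: "sjoin c d = 1 \<Longrightarrow> plim c d = 1"
  by (rule LIMSEQ_unique[OF plim]) (simp add: sjoin_power_eq_one)

text \<open>Squaring only shifts the sequence of powers by one index, so the gap between the two
  bounds vanishes in the limit.\<close>

lemma plim_additive:
  assumes "\<And>e. sjoin e x + sjoin e d \<le> 1 + sjoin e y"
    and "\<And>e. 1 + sjoin (square e) y \<le> sjoin e x + sjoin e d"
  shows "plim c x + plim c d = 1 + plim c y"
proof (rule antisym)
  note lims = tendsto_add[OF plim plim] tendsto_add[OF tendsto_const plim]
  show "plim c x + plim c d \<le> 1 + plim c y"
    by (rule LIMSEQ_le[OF lims]) (simp add: assms(1))
  show "1 + plim c y \<le> plim c x + plim c d"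
    by (rule LIMSEQ_le[OF LIMSEQ_Suc[OF lims(2)] lims(1)]) (simp add: assms(2) power_Suc)
qed

lemma plim_imp1_of_le: "y \<^bold>\<le> x \<Longrightarrow> plim c x + plim c (x \<^bold>\<rightarrow> y) = 1 + plim c y"
  by (intro plim_additive sjoin_superadditive1 sjoin_subadditive1)

lemma plim_imp2_of_le: "y \<^bold>\<le> x \<Longrightarrow> plim c x + plim c (x \<^bold>\<leadsto> y) = 1 + plim c y"
  by (intro plim_additive mirror.sjoin_superadditive1[unfolded mirror_sjoin] sjoin_subadditive2)

text \<open>The joins in either order are equivalent modulo the kernel, so \<open>plim\<close>
  agrees on them; \<open>join_imp1\<close> reduces the rest to comparable elements.\<close>

lemma plim_imp1_comm: "plim c x + plim c (x \<^bold>\<rightarrow> y) = plim c y + plim c (y \<^bold>\<rightarrow> x)"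
proof -
  have "plim c ((x \<^bold>\<rightarrow> y) \<^bold>\<leadsto> y) \<le> plim c ((y \<^bold>\<rightarrow> x) \<^bold>\<leadsto> x)" for x y
    by (intro plim_mono join_sle sle_of_le le_imp1_imp2 mirror.le_imp1)
  then have "plim c ((x \<^bold>\<rightarrow> y) \<^bold>\<leadsto> y) = plim c ((y \<^bold>\<rightarrow> x) \<^bold>\<leadsto> x)"
    by (intro antisym)
  then show ?thesis
    using plim_imp1_of_le[OF mirror.le_imp1[of y "x \<^bold>\<rightarrow> y"], of c]
      plim_imp1_of_le[OF mirror.le_imp1[of x "y \<^bold>\<rightarrow> x"], of c]
    by (simp add: join_imp1)
qed

lemma plim_imp2_comm: "plim c x + plim c (x \<^bold>\<leadsto> y) = plim c y + plim c (y \<^bold>\<leadsto> x)"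
proof -
  have "plim c ((x \<^bold>\<leadsto> y) \<^bold>\<rightarrow> y) \<le> plim c ((y \<^bold>\<leadsto> x) \<^bold>\<rightarrow> x)" for x y
    by (intro plim_mono mirror.join_sle[unfolded mirror_sle] sle_of_le le_imp2_imp1 le_imp1)
  then have "plim c ((x \<^bold>\<leadsto> y) \<^bold>\<rightarrow> y) = plim c ((y \<^bold>\<leadsto> x) \<^bold>\<rightarrow> x)"
    by (intro antisym)
  then show ?thesis
    using plim_imp2_of_le[OF le_imp1[of y "x \<^bold>\<leadsto> y"], of c]
      plim_imp2_of_le[OF le_imp1[of x "y \<^bold>\<leadsto> x"], of c]
    by (simp add: mirror.join_imp1)
qed

end

section \<open>Extreme points of compact sets of functions\<close>

text \<open>For \<open>F = {v}\<close> this says that \<open>v\<close> is an extreme point of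
  \<open>K\<close>.\<close>

definition convex_face :: "('a \<Rightarrow> real) set \<Rightarrow> ('a \<Rightarrow> real) set \<Rightarrow> bool" where
  "convex_face F K \<longleftrightarrow> F \<subseteq> K \<and>
    (\<forall>p\<in>K. \<forall>q\<in>K. \<forall>l. 0 < l \<longrightarrow> l < 1 \<longrightarrow> (\<lambda>x. l * p x + (1 - l) * q x) \<in> F \<longrightarrow> p \<in> F \<and> q \<in> F)"

text \<open>An affine functional whose minimum is attained strictly between two points of
  \<open>F\<close> is equal at both.\<close>

lemma convex_face_argmin:
  fixes \<phi> :: "('a \<Rightarrow> real) \<Rightarrow> real"
  assumes face: "convex_face F K"
    and affine: "\<And>p q l. \<phi> (\<lambda>x. l * p x + (1 - l) * q x) = l * \<phi> p + (1 - l) * \<phi> q"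
  shows "convex_face {v \<in> F. \<forall>u\<in>F. \<phi> v \<le> \<phi> u} K"
  unfolding convex_face_def
proof (intro conjI ballI allI impI)
  show "{v \<in> F. \<forall>u\<in>F. \<phi> v \<le> \<phi> u} \<subseteq> K" using face by (auto simp: convex_face_def)
  fix p q and l :: real
  assume "p \<in> K" "q \<in> K" and l: "0 < l" "l < 1"
    and m: "(\<lambda>x. l * p x + (1 - l) * q x) \<in> {v \<in> F. \<forall>u\<in>F. \<phi> v \<le> \<phi> u}"
  then have pq: "p \<in> F" "q \<in> F" using face unfolding convex_face_def by blast+
  have "l * \<phi> p + (1 - l) * \<phi> q \<le> \<phi> p" "l * \<phi> p + (1 - l) * \<phi> q \<le> \<phi> q"
    using m pq by (auto simp: affine)
  then have "(1 - l) * (\<phi> q - \<phi> p) \<le> 0" "l * (\<phi> p - \<phi> q) \<le> 0"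
    by (simp_all add: algebra_simps)
  then have "\<phi> p = \<phi> q" using l by (simp add: mult_le_0_iff)
  then have "\<phi> (\<lambda>x. l * p x + (1 - l) * q x) = \<phi> p" "\<phi> p = \<phi> q"
    unfolding affine by (simp_all add: algebra_simps)
  then show "p \<in> {v \<in> F. \<forall>u\<in>F. \<phi> v \<le> \<phi> u}" "q \<in> {v \<in> F. \<forall>u\<in>F. \<phi> v \<le> \<phi> u}"
    using m pq by auto
qed

lemma convex_face_Inter:
  assumes "\<C> \<noteq> {}" "\<And>F. F \<in> \<C> \<Longrightarrow> convex_face F K"
  shows "convex_face (\<Inter>\<C>) K"
  unfolding convex_face_def
proof (intro conjI ballI allI impI)
  show "\<Inter>\<C> \<subseteq> K" using assms unfolding convex_face_def by blast
  fix p q and l :: real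
  assume "p \<in> K" "q \<in> K" "0 < l" "l < 1" "(\<lambda>x. l * p x + (1 - l) * q x) \<in> \<Inter>\<C>"
  then have "p \<in> F \<and> q \<in> F" if "F \<in> \<C>" for F
    using assms(2)[OF that] that unfolding convex_face_def by blast
  then show "p \<in> \<Inter>\<C>" "q \<in> \<Inter>\<C>" by blast+
qed

lemma closed_argmin:
  fixes \<phi> :: "'b::topological_space \<Rightarrow> real"
  assumes "compact K" "closed F" "F \<subseteq> K" "F \<noteq> {}" "continuous_on UNIV \<phi>"
  shows "closed {v \<in> F. \<forall>u\<in>F. \<phi> v \<le> \<phi> u}" "{v \<in> F. \<forall>u\<in>F. \<phi> v \<le> \<phi> u} \<noteq> {}"
proof -
  have "compact F" using compact_Int_closed[OF assms(1,2)] assms(3) by (simp add: Int_absorb1)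
  then obtain v where v: "v \<in> F" "\<forall>u\<in>F. \<phi> v \<le> \<phi> u"
    using continuous_attains_inf[of F \<phi>] assms(4,5) continuous_on_subset by blast
  then show "{v \<in> F. \<forall>u\<in>F. \<phi> v \<le> \<phi> u} \<noteq> {}" by blast
  have "{v \<in> F. \<forall>u\<in>F. \<phi> v \<le> \<phi> u} = F \<inter> {u. \<phi> u \<le> \<phi> v}"
    using v by (auto intro: order_trans)
  then show "closed {v \<in> F. \<forall>u\<in>F. \<phi> v \<le> \<phi> u}"
    using assms(2,5) by (auto intro!: closed_Int closed_Collect_le)
qed

text \<open>A minimal closed face is a singleton, since every coordinate is constant on it.\<close>

lemma exists_extreme_minimizer:
  fixes \<phi> :: "('a \<Rightarrow> real) \<Rightarrow> real"
  assumes K: "compact K" "closed K" "K \<noteq> {}" and cont: "continuous_on UNIV \<phi>"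
    and affine: "\<And>p q l. \<phi> (\<lambda>x. l * p x + (1 - l) * q x) = l * \<phi> p + (1 - l) * \<phi> q"
  obtains v where "convex_face {v} K" "\<And>u. u \<in> K \<Longrightarrow> \<phi> v \<le> \<phi> u"
proof -
  define F0 where "F0 = {v \<in> K. \<forall>u\<in>K. \<phi> v \<le> \<phi> u}"
  define \<A> where "\<A> = {F. closed F \<and> F \<noteq> {} \<and> convex_face F K \<and> F \<subseteq> F0}"
  have F0: "F0 \<in> \<A>"
    using closed_argmin[OF K(1,2) order_refl K(3) cont]
      convex_face_argmin[where F = K and K = K and \<phi> = \<phi>, OF _ affine]
    by (auto simp: \<A>_def F0_def convex_face_def)
  \<comment> \<open>Zorn for reverse inclusion: a nonempty chain is bounded by its intersection,
    which is nonempty by compactness.\<close>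
  have "\<exists>M\<in>\<A>. \<forall>X\<in>\<A>. M \<supseteq> X \<longrightarrow> X = M"
  proof (rule predicate_Zorn)
    show "partial_order_on \<A> (relation_of (\<supseteq>) \<A>)"
      by (auto simp: relation_of_def partial_order_on_def preorder_on_def refl_on_def
          trans_def antisym_def)
    fix \<C> assume "\<C> \<in> Chains (relation_of (\<supseteq>) \<A>)"
    then have chain: "\<And>X Y. X \<in> \<C> \<Longrightarrow> Y \<in> \<C> \<Longrightarrow> X \<in> \<A> \<and> (X \<subseteq> Y \<or> Y \<subseteq> X)"
      by (auto simp: Chains_def relation_of_def)
    show "\<exists>U\<in>\<A>. \<forall>X\<in>\<C>. X \<supseteq> U"
    proof (cases "\<C> = {}")
      case True
      then show ?thesis using F0 by blast
    next
      case False
      have mem: "closed X" "X \<noteq> {}" "convex_face X K" "X \<subseteq> F0" "X \<subseteq> K" if "X \<in> \<C>" for X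
        using chain[OF that that] by (auto simp: \<A>_def convex_face_def)
      have fin: "\<exists>X\<in>\<C>. X \<subseteq> \<Inter>\<F>" if "finite \<F>" "\<F> \<subseteq> \<C>" for \<F>
        using that
      proof (induction \<F>)
        case empty
        then show ?case using False by auto
      next
        case (insert Y \<F>)
        then obtain X where "X \<in> \<C>" "X \<subseteq> \<Inter>\<F>" by auto
        then show ?case using chain[of X Y] insert.prems by (auto 4 3)
      qed
      have "K \<inter> \<Inter>\<C> \<noteq> {}"
      proof (rule compact_imp_fip[OF K(1)])
        fix \<F> assume "finite \<F>" "\<F> \<subseteq> \<C>"
        then obtain X where "X \<in> \<C>" "X \<subseteq> \<Inter>\<F>" using fin by blast
        then show "K \<inter> \<Inter>\<F> \<noteq> {}" using mem(2,5)[of X] by blast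
      qed (use mem in auto)
      then have "\<Inter>\<C> \<in> \<A>"
        using mem False convex_face_Inter[OF False, of K] unfolding \<A>_def
        by (auto simp: Inf_less_eq)
      then show ?thesis by blast
    qed
  qed
  then obtain M where M: "M \<in> \<A>" "\<And>X. X \<in> \<A> \<Longrightarrow> X \<subseteq> M \<Longrightarrow> X = M" by blast
  then have Mf: "closed M" "M \<noteq> {}" "convex_face M K" "M \<subseteq> F0" "M \<subseteq> K"
    by (auto simp: \<A>_def convex_face_def)
  have const: "u a \<le> v a" if "u \<in> M" "v \<in> M" for u v a
  proof -
    have "{v \<in> M. \<forall>u\<in>M. v a \<le> u a} \<in> \<A>"
      unfolding \<A>_def
      using closed_argmin[OF K(1) Mf(1,5,2) continuous_on_product_coordinates[of a]]
        convex_face_argmin[OF Mf(3), of "\<lambda>v. v a"] Mf(4) by auto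
    then have "{v \<in> M. \<forall>u\<in>M. v a \<le> u a} = M" using M(2) by blast
    then show ?thesis using that by blast
  qed
  obtain v where v: "v \<in> M" using Mf(2) by blast
  have "M = {v}" using const v by (auto intro!: ext antisym)
  then show ?thesis
    using that[of v] Mf(3,4) by (auto simp: F0_def)
qed

section \<open>Extreme Bosbach states\<close>

lemma bosbach_states_closed: "closed (bosbach_states imp1 imp2 one zero)"
proof -
  have coord: "continuous_on UNIV (\<lambda>v :: 'a \<Rightarrow> real. v x)" for x
    by simp
  show ?thesis
    unfolding bosbach_states_def atLeastAtMost_iff
    by (intro closed_Collect_conj closed_Collect_all closed_Collect_le closed_Collect_eq
        continuous_on_add continuous_on_const coord)
qed

lemma bosbach_states_compact: "compact (bosbach_states imp1 imp2 one zero)"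
proof -
  have "compactin (product_topology (\<lambda>_ :: 'a. euclideanreal) UNIV) (\<Pi>\<^sub>E _\<in>UNIV. {0..1})"
    by (simp add: compactin_PiE)
  then have "compact (\<Pi>\<^sub>E _\<in>(UNIV :: 'a set). {0..1::real})"
    by (simp add: euclidean_product_topology)
  then have "compact ((\<Pi>\<^sub>E _\<in>UNIV. {0..1}) \<inter> bosbach_states imp1 imp2 one zero)"
    by (rule compact_Int_closed[OF _ bosbach_states_closed])
  moreover have "bosbach_states imp1 imp2 one zero \<subseteq> (\<Pi>\<^sub>E _\<in>UNIV. {0..1})"
    by (auto simp: bosbach_states_def)
  ultimately show ?thesis by (simp add: Int_absorb1)
qed

context bosbach_state
begin

text \<open>The order modulo the kernel of an extreme state is linear, so no truncation remains to
  be decided in \<open>s (x \<rightarrow> y)\<close>.\<close>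

lemma extreme_total:
  assumes "convex_face {s} (bosbach_states (\<^bold>\<rightarrow>) (\<^bold>\<leadsto>) \<^bold>1 \<^bold>0)"
  shows "sle x y \<or> sle y x"
proof -
  define c where "c = (x \<^bold>\<rightarrow> y)"
  define r where "r = plim c"
  define \<alpha> where "\<alpha> = r \<^bold>0"
  \<comment> \<open>These bounds put the values of \<open>p\<close> and \<open>q\<close> below into
    the unit interval.\<close>
  have bounds: "s z \<le> r z" "r z \<le> 1" "r z \<le> \<alpha> + s z" "\<alpha> \<le> r z" for z
    unfolding r_def \<alpha>_def
    by (intro s_le_plim plim_le_one plim_le_add plim_mono sle_of_le zero_le)+
  have comm: "r z + r (z \<^bold>\<rightarrow> w) = r w + r (w \<^bold>\<rightarrow> z)" "r z + r (z \<^bold>\<leadsto> w) = r w + r (w \<^bold>\<leadsto> z)" for z w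
    unfolding r_def by (rule plim_imp1_comm plim_imp2_comm)+
  have r1: "r \<^bold>1 = 1" using bounds(1,2)[of "\<^bold>1"] by (simp add: s_one)
  have "0 \<le> \<alpha>" "\<alpha> \<le> 1" using bounds(1,2)[of "\<^bold>0"] by (simp_all add: s_zero \<alpha>_def)
  then consider "\<alpha> = 0" | "\<alpha> = 1" | "0 < \<alpha>" "\<alpha> < 1" by linarith
  then show ?thesis
  proof cases
    case 1
    then have "s (y \<^bold>\<rightarrow> x) = r (y \<^bold>\<rightarrow> x)" using bounds(1,3) by (simp add: antisym)
    also have "\<dots> = 1" unfolding r_def c_def by (rule plim_eq_one[OF prelinear])
    finally show ?thesis by (simp add: sle_def)
  next
    case 2
    then have "s c = 1" using bounds(2,4)[of c] plim_self[of c] by (simp add: r_def)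
    then show ?thesis by (simp add: sle_def c_def)
  next
    case 3
    define p where "p z = (r z - \<alpha>) / (1 - \<alpha>)" for z
    define q where "q z = (s z - r z + \<alpha>) / \<alpha>" for z
    have s_eq: "(\<lambda>z. (1 - \<alpha>) * p z + (1 - (1 - \<alpha>)) * q z) = s"
      using 3 by (auto simp: p_def q_def)
    have "p \<in> bosbach_states (\<^bold>\<rightarrow>) (\<^bold>\<leadsto>) \<^bold>1 \<^bold>0"
      using 3 bounds(2,4) comm r1
      by (auto simp: bosbach_states_def p_def \<alpha>_def[symmetric] simp flip: add_divide_distrib)
    moreover have "q \<in> bosbach_states (\<^bold>\<rightarrow>) (\<^bold>\<leadsto>) \<^bold>1 \<^bold>0"
      using 3 bounds(1,3) comm r1 s_imp1_comm mirror.s_imp1_comm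
      by (auto simp: bosbach_states_def q_def s_zero s_one \<alpha>_def[symmetric] algebra_simps
          simp flip: add_divide_distrib)
    moreover have "0 < 1 - \<alpha>" "1 - \<alpha> < 1" using 3 by simp_all
    ultimately have "p = s"
      using assms s_eq unfolding convex_face_def by (metis singletonD singletonI)
    \<comment> \<open>At \<open>c\<close> the functions \<open>r\<close> and \<open>s\<close> agree,
      so a nonzero \<open>\<alpha>\<close> forces \<open>s c = 1\<close>.\<close>
    then have "r c - \<alpha> = (1 - \<alpha>) * s c"
      using 3 by (auto simp: p_def field_simps dest!: fun_cong[of _ _ c])
    then have "\<alpha> * (1 - s c) = 0"
      using plim_self[of c] by (simp add: r_def algebra_simps)
    then show ?thesis using 3 by (simp add: sle_def c_def)
  qed
qed

lemma extreme_state_morphism: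
  assumes "convex_face {s} (bosbach_states (\<^bold>\<rightarrow>) (\<^bold>\<leadsto>) \<^bold>1 \<^bold>0)"
  shows "s \<in> state_morphisms (\<^bold>\<rightarrow>) (\<^bold>\<leadsto>) \<^bold>0"
proof -
  have "s (x \<^bold>\<rightarrow> y) = min (1 - s x + s y) 1" for x y
    using extreme_total[OF assms, of x y]
  proof
    assume "sle x y"
    then show ?thesis using sle_s_mono[of x y] by (simp add: sle_def)
  next
    assume "sle y x"
    then show ?thesis using sle_s_mono[of y x] s_imp1_of_sle[of y x] by simp
  qed
  then show ?thesis
    by (simp add: state_morphisms_def s_imp2 s_bounds s_zero)
qed

end

section \<open>Bosbach states are de Finetti maps\<close>

lemma bosbach_states_subset_de_finetti_maps:
  assumes "bounded_pseudo_BCK le imp1 imp2 one zero"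
  shows "bosbach_states imp1 imp2 one zero \<subseteq> de_finetti_maps (state_morphisms imp1 imp2 zero)"
proof
  let ?B = "bosbach_states imp1 imp2 one zero"
  fix s assume s: "s \<in> ?B"
  have "\<exists>V\<in>state_morphisms imp1 imp2 zero. 0 \<le> (\<Sum>a\<in>A. \<sigma> a * (s a - V a))"
    for A and \<sigma> :: "'a \<Rightarrow> real"
  proof -
    define \<phi> where "\<phi> v = (\<Sum>a\<in>A. \<sigma> a * v a)" for v :: "'a \<Rightarrow> real"
    have cont: "continuous_on UNIV \<phi>"
      unfolding \<phi>_def by (intro continuous_intros) simp
    have affine: "\<phi> (\<lambda>x. l * p x + (1 - l) * q x) = l * \<phi> p + (1 - l) * \<phi> q" for p q l
      by (simp add: \<phi>_def sum_distrib_left sum.distrib sum_subtractf algebra_simps)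
    have "?B \<noteq> {}" using s by blast
    then obtain v where v: "convex_face {v} ?B" "\<And>u. u \<in> ?B \<Longrightarrow> \<phi> v \<le> \<phi> u"
      by (rule exists_extreme_minimizer[OF bosbach_states_compact bosbach_states_closed _ cont affine])
        (rule that)
    then have "bosbach_state le imp1 imp2 one zero v"
      using assms by (auto simp: bosbach_state_def bosbach_state_axioms_def convex_face_def)
    then have "v \<in> state_morphisms imp1 imp2 zero"
      by (rule bosbach_state.extreme_state_morphism[OF _ v(1)])
    moreover have "0 \<le> (\<Sum>a\<in>A. \<sigma> a * (s a - v a))"
      using v(2)[OF s] by (simp add: \<phi>_def sum_subtractf algebra_simps)
    ultimately show ?thesis by blast
  qed
  then show "s \<in> de_finetti_maps (state_morphisms imp1 imp2 zero)"
    using s by (auto simp: de_finetti_maps_def coherent_over_def bosbach_states_def)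
qed

section \<open>De Finetti maps\<close>

text \<open>Adding \<open>m x\<close> to \<open>min (1 - m x + m y) 1\<close> gives
  \<open>1 + min (m x) (m y)\<close>, which is symmetric.\<close>

lemma state_morphisms_subset_bosbach_states:
  assumes "bounded_pseudo_BCK le imp1 imp2 one zero"
  shows "state_morphisms imp1 imp2 zero \<subseteq> bosbach_states imp1 imp2 one zero"
proof
  interpret bounded_pseudo_BCK le imp1 imp2 one zero by fact
  fix m assume m: "m \<in> state_morphisms imp1 imp2 zero"
  \<comment> \<open>The value at \<open>one\<close> is not prescribed for state-morphisms; it is
    read off from this implication.\<close>
  have "imp1 zero zero = one" using le_refl le_iff_imp1 by blast
  then have "m one = min (1 - m zero + m zero) 1"
    using m by (auto simp: state_morphisms_def)
  then show "m \<in> bosbach_states imp1 imp2 one zero"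
    using m by (auto simp: state_morphisms_def bosbach_states_def min_def)
qed

text \<open>Coherence for \<open>\<sigma>\<close> and for its negative gives the two
  inequalities.\<close>

lemma de_finetti_maps_linear:
  assumes \<beta>: "\<beta> \<in> de_finetti_maps W" and "finite A"
    and eq: "\<And>V. V \<in> W \<Longrightarrow> (\<Sum>a\<in>A. \<sigma> a * V a) = k"
  shows "(\<Sum>a\<in>A. \<sigma> a * \<beta> a) = k"
proof -
  have coh: "\<exists>V\<in>W. 0 \<le> (\<Sum>a\<in>A. \<tau> a * (\<beta> a - V a))" for \<tau> :: "'a \<Rightarrow> real"
    using \<beta> \<open>finite A\<close> by (auto simp: de_finetti_maps_def coherent_over_def)
  show ?thesis
    using coh[of \<sigma>] coh[of "\<lambda>a. - \<sigma> a"] eq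
    by (force simp: right_diff_distrib sum_subtractf sum_negf)
qed

lemma de_finetti_maps_subset_bosbach_states:
  assumes W: "W \<subseteq> bosbach_states imp1 imp2 one zero"
  shows "de_finetti_maps W \<subseteq> bosbach_states imp1 imp2 one zero"
proof
  fix \<beta> assume \<beta>: "\<beta> \<in> de_finetti_maps W"
  have four: "\<beta> a + \<beta> b = \<beta> c + \<beta> d" if "\<And>V. V \<in> W \<Longrightarrow> V a + V b = V c + V d" for a b c d
  proof -
    \<comment> \<open>A sum of indicators, so that coincidences among the four points are counted
      with multiplicity.\<close>
    define \<sigma> :: "'a \<Rightarrow> real" where
      "\<sigma> z = of_bool (z = a) + of_bool (z = b) - of_bool (z = c) - of_bool (z = d)" for z
    have "(\<Sum>z\<in>{a, b, c, d}. \<sigma> z * f z) = f a + f b - f c - f d" for f :: "'a \<Rightarrow> real"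
      by (simp only: \<sigma>_def left_diff_distrib distrib_right sum.distrib sum_subtractf of_bool_def
          if_distrib[of "\<lambda>u. u * _"] mult_1 mult_zero_left) simp
    then show ?thesis
      using de_finetti_maps_linear[OF \<beta>, of "{a, b, c, d}" \<sigma> 0] that by simp
  qed
  have one: "\<beta> a = k" if "\<And>V. V \<in> W \<Longrightarrow> V a = k" for a k
    using de_finetti_maps_linear[OF \<beta>, of "{a}" "\<lambda>_. 1" k] that by simp
  have "\<forall>x. \<beta> x \<in> {0..1}" using \<beta> by (simp add: de_finetti_maps_def)
  moreover have "\<beta> zero = 0" "\<beta> one = 1"
    using W by (auto intro!: one simp: bosbach_states_def)
  moreover have "\<beta> x + \<beta> (imp1 x y) = \<beta> y + \<beta> (imp1 y x)"
    "\<beta> x + \<beta> (imp2 x y) = \<beta> y + \<beta> (imp2 y x)" for x y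
    using W by (auto intro!: four simp: bosbach_states_def)
  ultimately show "\<beta> \<in> bosbach_states imp1 imp2 one zero"
    unfolding bosbach_states_def by blast
qed

theorem theorem6p2:
  fixes le :: "'a \<Rightarrow> 'a \<Rightarrow> bool"
    and imp1 imp2 :: "'a \<Rightarrow> 'a \<Rightarrow> 'a"
    and one zero :: 'a
  assumes "bounded_pseudo_BCK le imp1 imp2 one zero"
    and "state_morphisms imp1 imp2 zero \<noteq> {}"
  shows "de_finetti_maps (state_morphisms imp1 imp2 zero) = bosbach_states imp1 imp2 one zero"
  using bosbach_states_subset_de_finetti_maps[OF assms(1)]
    de_finetti_maps_subset_bosbach_states[OF state_morphisms_subset_bosbach_states[OF assms(1)]]
  by (rule antisym[rotated])

end
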